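(* Let $\mathbb{D}$ be the open unit disc in $\mathbb{C}$ and let $\rho$ be the hyperbolic distance on $\mathbb{D}$. Suppose that $f$ is either the identity function on $\mathbb{D}$ or an elliptic Möbius transformation that fixes $\mathbb{D}$, and that $f_1,f_2,\dotsc$ are non-constant holomorphic self-maps of $\mathbb{D}$ for which \[ \sum_{n=1}^\infty \rho(f_n(a),f(a))<+\infty\quad\text{and}\quad\sum_{n=1}^\infty \rho(f_n(b),f(b))<+\infty, \] for two distinct points $a,b\in\mathbb{D}$. Then the sequence $(f^{-n}\circ F_n)_{n\geq 1}$, where $F_n=f_n\circ f_{n-1}\circ\dotsb\circ f_1$, converges locally uniformly on $\mathbb{D}$ to a non-constant holomorphic self-map of $\mathbb{D}$.
   Context: $\mathbb{D}=\{z\in\mathbb{C}:|z|<1\}$. A holomorphic self-map of $\mathbb{D}$ is a holomorphic function $\mathbb{D}\to\mathbb{D}$. The hyperbolic distance $\rho$ on $\mathbb{D}$ is the distance function of the Riemannian metric $2|dz|/(1-|z|^2)$; equivalently $\sinh\tfrac12\rho(z,w)=|z-w|/\sqrt{(1-|z|^2)(1-|w|^2)}$. An elliptic Möbius transformation that fixes $\mathbb{D}$ is a conformal automorphism of $\mathbb{D}$ that is conjugate, by another conformal automorphism of $\mathbb{D}$, to a rotation about the origin. For a conformal automorphism $f$ of $\mathbb{D}$, $f^n$ is the $n$-fold composition of $f$ with itself and $f^{-n}$ is the inverse function of $f^n$. Locally uniform convergence on $\mathbb{D}$ means uniform convergence on compact subsets of $\mathbb{D}$ with respect to the Euclidean metric.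 *)

theory Defs
  imports "HOL-Complex_Analysis.Complex_Analysis"
begin

abbreviation unit_disc :: "complex set" where
  "unit_disc \<equiv> ball 0 1"

definition hyperbolic_length :: "(real \<Rightarrow> complex) \<Rightarrow> real" where
  "hyperbolic_length \<gamma> =
     integral {0..1} (\<lambda>t. 2 * norm (vector_derivative \<gamma> (at t)) / (1 - (norm (\<gamma> t))\<^sup>2))"

text \<open>
  The curves are required to be \<open>C\<^sup>1\<close> on the whole of \<open>{0..1}\<close>, which does not change the infimum
  over piecewise \<open>C\<^sup>1\<close> curves. The library's \<^const>\<open>valid_path\<close> would be wrong here: it allows the
  derivative to be unbounded near the exceptional points, and for a curve of infinite length
  \<^const>\<open>integral\<close> returns the default value 0.
\<close>

definition hyperbolic_dist :: "complex \<Rightarrow> complex \<Rightarrow> real" where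
  "hyperbolic_dist z w =
     Inf {hyperbolic_length \<gamma> |\<gamma>. \<gamma> C1_differentiable_on {0..1} \<and> \<gamma> ` {0..1} \<subseteq> unit_disc
            \<and> \<gamma> 0 = z \<and> \<gamma> 1 = w}"

definition disc_self_map :: "(complex \<Rightarrow> complex) \<Rightarrow> bool" where
  "disc_self_map f \<longleftrightarrow> f holomorphic_on unit_disc \<and> f ` unit_disc \<subseteq> unit_disc"

definition disc_automorphism :: "(complex \<Rightarrow> complex) \<Rightarrow> bool" where
  "disc_automorphism f \<longleftrightarrow> f holomorphic_on unit_disc \<and> bij_betw f unit_disc unit_disc"

text \<open>
  The equation says that \<open>\<phi> \<circ> f \<circ> \<phi>\<inverse>\<close> is the rotation \<open>w \<mapsto> c w\<close> on the disc. The trivial rotation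
  \<open>c = 1\<close> is not excluded, so the identity counts as elliptic.
\<close>

definition disc_elliptic :: "(complex \<Rightarrow> complex) \<Rightarrow> bool" where
  "disc_elliptic f \<longleftrightarrow> disc_automorphism f \<and>
     (\<exists>\<phi> c. disc_automorphism \<phi> \<and> norm c = 1 \<and> (\<forall>z\<in>unit_disc. \<phi> (f z) = c * \<phi> z))"

text \<open>\<open>left_comp f n = f n \<circ> \<dots> \<circ> f 1\<close>; the term \<open>f 0\<close> is not used.\<close>

primrec left_comp :: "(nat \<Rightarrow> 'a \<Rightarrow> 'a) \<Rightarrow> nat \<Rightarrow> 'a \<Rightarrow> 'a" where
  "left_comp f 0 = id"
| "left_comp f (Suc n) = f (Suc n) \<circ> left_comp f n"

text \<open>\<open>f\<^sup>-\<^sup>n\<close> as a map of the disc; its values off the disc are irrelevant.\<close>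

definition disc_inv_iter :: "(complex \<Rightarrow> complex) \<Rightarrow> nat \<Rightarrow> complex \<Rightarrow> complex" where
  "disc_inv_iter f n = inv_into unit_disc (f ^^ n)"

definition converges_locally_uniformly_on_disc ::
    "(nat \<Rightarrow> complex \<Rightarrow> complex) \<Rightarrow> (complex \<Rightarrow> complex) \<Rightarrow> bool" where
  "converges_locally_uniformly_on_disc h g \<longleftrightarrow>
     (\<forall>K. compact K \<and> K \<subseteq> unit_disc \<longrightarrow> uniform_limit K h g sequentially)"


subsection \<open>The closed form of the hyperbolic distance\<close>

lemma disc_denom_nonzero:
  assumes "norm z < 1" "norm w < 1"
  shows "1 - cnj z * w \<noteq> 0"
proof
  assume "1 - cnj z * w = 0"
  then have "norm (cnj z * w) = 1" by simp
  then show False using assms norm_mult_less[of "cnj z" 1 w 1] by simp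
qed

lemma Moebius_function_norm_identity:
  assumes "norm z < 1" "norm w < 1"
  shows "1 - (norm (Moebius_function 0 z w))\<^sup>2
           = (1 - (norm z)\<^sup>2) * (1 - (norm w)\<^sup>2) / (norm (1 - cnj z * w))\<^sup>2"
proof -
  have n: "(norm (1 - cnj z * w))\<^sup>2 \<noteq> 0" using disc_denom_nonzero[OF assms] by simp
  have "(norm (1 - cnj z * w))\<^sup>2 - (norm (w - z))\<^sup>2 = (1 - (norm z)\<^sup>2) * (1 - (norm w)\<^sup>2)"
    unfolding cmod_power2 by (simp add: power2_eq_square algebra_simps)
  then show ?thesis using n
    by (simp add: Moebius_function_simple norm_divide power_divide field_simps)
qed

lemma Moebius_function_deriv:
  assumes "norm z < 1" "norm w < 1"
  shows "(Moebius_function 0 z has_field_derivative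
           (of_real (1 - (norm z)\<^sup>2) / (1 - cnj z * w)\<^sup>2)) (at w)"
proof -
  have e: "of_real (1 - (norm z)\<^sup>2) = 1 - cnj z * z"
    using complex_norm_square[of z] by (simp add: mult.commute)
  have "((\<lambda>v. (v - z) / (1 - cnj z * v)) has_field_derivative
           (of_real (1 - (norm z)\<^sup>2) / (1 - cnj z * w)\<^sup>2)) (at w)"
    unfolding e using disc_denom_nonzero[OF assms]
    by (auto intro!: derivative_eq_intros simp: power2_eq_square field_simps)
  then show ?thesis by (simp add: Moebius_function_simple[abs_def])
qed

lemma Moebius_function_isometry:
  assumes "norm z < 1" "norm w < 1"
  shows "norm (of_real (1 - (norm z)\<^sup>2) / (1 - cnj z * w)\<^sup>2) / (1 - (norm (Moebius_function 0 z w))\<^sup>2)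
           = 1 / (1 - (norm w)\<^sup>2)"
proof -
  have p: "1 - (norm z)\<^sup>2 > 0" "1 - (norm w)\<^sup>2 > 0"
    using assms by (simp_all add: abs_square_less_1)
  have "norm (of_real (1 - (norm z)\<^sup>2) / (1 - cnj z * w)\<^sup>2)
      = (1 - (norm z)\<^sup>2) / (norm (1 - cnj z * w))\<^sup>2"
    using p by (simp add: norm_divide norm_power del: of_real_diff of_real_power)
  then show ?thesis
    unfolding Moebius_function_norm_identity[OF assms]
    using p disc_denom_nonzero[OF assms] by simp
qed

lemma hyperbolic_length_ge:
  assumes C1: "\<gamma> C1_differentiable_on {0..1}" and im: "\<gamma> ` {0..1} \<subseteq> unit_disc"
  shows "2 * artanh (norm (Moebius_function 0 (\<gamma> 0) (\<gamma> 1))) \<le> hyperbolic_length \<gamma>"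
proof -
  define T where "T = Moebius_function 0 (\<gamma> 0)"
  define u where "u = T (\<gamma> 1)"
  define c where "c = (if u = 0 then 1 else cnj u / of_real (norm u))"
  define D where "D w = of_real (1 - (norm (\<gamma> 0))\<^sup>2) / (1 - cnj (\<gamma> 0) * w)\<^sup>2" for w :: complex
  obtain d where d: "\<And>t. t \<in> {0..1} \<Longrightarrow> (\<gamma> has_vector_derivative d t) (at t)"
    and dc: "continuous_on {0..1} d"
    using C1 unfolding C1_differentiable_on_def by blast
  have lt: "norm (\<gamma> t) < 1" if "t \<in> {0..1}" for t
    using subsetD[OF im imageI[OF that]] by simp
  have g0: "norm (\<gamma> 0) < 1" using lt by simp
  have Tlt: "norm (T (\<gamma> t)) < 1" if "t \<in> {0..1}" for t
    unfolding T_def using Moebius_function_norm_lt_1 g0 lt[OF that] by blast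
  have c1: "norm c = 1" by (simp add: c_def norm_divide)
  have cu: "Re (c * u) = norm u"
  proof (cases "u = 0")
    case False
    have "cnj u * u = of_real ((norm u)\<^sup>2)"
      by (metis complex_norm_square mult.commute of_real_power)
    then have "c * u = of_real (norm u)"
      using False by (simp add: c_def power2_eq_square)
    then show ?thesis by simp
  qed simp
  have Re_le: "\<bar>Re (c * v)\<bar> \<le> norm v" for v
    using abs_Re_le_cmod[of "c * v"] c1 by (simp add: norm_mult)
  define G where "G t = 2 * artanh (Re (c * T (\<gamma> t)))" for t
  define G' where "G' t = 2 * Re (c * (d t * D (\<gamma> t))) / (1 - (Re (c * T (\<gamma> t)))\<^sup>2)" for t
  have derG: "(G has_vector_derivative G' t) (at t within {0..1})" if t: "t \<in> {0..1}" for t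
  proof -
    have "((T \<circ> \<gamma>) has_vector_derivative d t * D (\<gamma> t)) (at t)"
      using field_vector_diff_chain_at[OF d[OF t]] Moebius_function_deriv[OF g0 lt[OF t]]
      unfolding T_def D_def by blast
    then have "((\<lambda>s. c * T (\<gamma> s)) has_vector_derivative c * (d t * D (\<gamma> t))) (at t)"
      unfolding o_def by (rule has_vector_derivative_mult_right)
    then have "((\<lambda>s. Re (c * T (\<gamma> s))) has_real_derivative Re (c * (d t * D (\<gamma> t)))) (at t)"
      by (simp add: has_real_derivative_iff_has_vector_derivative has_vector_derivative_complex_iff)
    moreover have "\<bar>Re (c * T (\<gamma> t))\<bar> < 1"
      using Re_le[of "T (\<gamma> t)"] Tlt[OF t] by linarith
    ultimately have "(G has_real_derivative
        2 * (1 / (1 - (Re (c * T (\<gamma> t)))\<^sup>2) * Re (c * (d t * D (\<gamma> t))))) (at t)"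
      unfolding G_def
      by (intro DERIV_cmult DERIV_chain2[OF artanh_real_has_field_derivative])
    then have "(G has_real_derivative G' t) (at t)"
      by (simp add: G'_def del: times_complex.sel)
    then show ?thesis
      by (metis has_real_derivative_iff_has_vector_derivative has_vector_derivative_at_within)
  qed
  then have "(G' has_integral G 1 - G 0) {0..1}"
    by (intro fundamental_theorem_of_calculus) auto
  moreover have "G 1 - G 0 = 2 * artanh (norm u)"
    using cu by (simp add: G_def u_def T_def Moebius_function_eq_zero)
  ultimately have iG: "(G' has_integral 2 * artanh (norm u)) {0..1}" by simp
  define L where "L t = 2 * norm (vector_derivative \<gamma> (at t)) / (1 - (norm (\<gamma> t))\<^sup>2)" for t
  have Leq: "L t = 2 * norm (d t) / (1 - (norm (\<gamma> t))\<^sup>2)" if "t \<in> {0..1}" for t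
    using vector_derivative_at[OF d[OF that]] by (simp add: L_def)
  have gc: "continuous_on {0..1} \<gamma>"
    using d by (meson continuous_at_imp_continuous_on has_vector_derivative_continuous)
  have sq: "1 - (norm (\<gamma> t))\<^sup>2 > 0" if "t \<in> {0..1}" for t
    using lt[OF that] by (simp add: abs_square_less_1)
  have "continuous_on {0..1} (\<lambda>t. 2 * norm (d t) / (1 - (norm (\<gamma> t))\<^sup>2))"
    using sq by (intro continuous_intros dc gc) fastforce
  then have "L integrable_on {0..1}"
    by (rule integrable_eq[OF integrable_continuous_interval]) (simp add: Leq)
  then have iL: "(L has_integral hyperbolic_length \<gamma>) {0..1}"
    unfolding hyperbolic_length_def L_def[symmetric] by (rule integrable_integral)
  have "G' t \<le> L t" if t: "t \<in> {0..1}" for t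
  proof -
    have a: "1 - (norm (T (\<gamma> t)))\<^sup>2 > 0" using Tlt[OF t] by (simp add: abs_square_less_1)
    have b: "1 - (norm (T (\<gamma> t)))\<^sup>2 \<le> 1 - (Re (c * T (\<gamma> t)))\<^sup>2"
      using power_mono[OF Re_le[of "T (\<gamma> t)"], of 2] by simp
    have "2 * Re (c * (d t * D (\<gamma> t))) \<le> 2 * (norm (d t) * norm (D (\<gamma> t)))"
      using Re_le[of "d t * D (\<gamma> t)"] by (simp add: norm_mult)
    then have "G' t \<le> 2 * (norm (d t) * norm (D (\<gamma> t))) / (1 - (norm (T (\<gamma> t)))\<^sup>2)"
      unfolding G'_def using a b by (intro frac_le) auto
    also have "\<dots> = 2 * norm (d t) * (norm (D (\<gamma> t)) / (1 - (norm (T (\<gamma> t)))\<^sup>2))" by simp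
    also have "norm (D (\<gamma> t)) / (1 - (norm (T (\<gamma> t)))\<^sup>2) = 1 / (1 - (norm (\<gamma> t))\<^sup>2)"
      unfolding D_def T_def by (rule Moebius_function_isometry[OF g0 lt[OF t]])
    finally show ?thesis using Leq[OF t] by simp
  qed
  then show ?thesis
    using has_integral_le[OF iG iL] by (simp add: u_def T_def)
qed

lemma hyperbolic_length_attained:
  assumes z: "norm z < 1" and w: "norm w < 1"
  obtains \<gamma> where "\<gamma> C1_differentiable_on {0..1}" "\<gamma> ` {0..1} \<subseteq> unit_disc" "\<gamma> 0 = z" "\<gamma> 1 = w"
    "hyperbolic_length \<gamma> = 2 * artanh (norm (Moebius_function 0 z w))"
proof -
  define u where "u = Moebius_function 0 z w"
  have u: "norm u < 1" unfolding u_def using Moebius_function_norm_lt_1 z w by blast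
  have mz: "norm (-z) < 1" using z by simp
  define \<gamma> where "\<gamma> t = Moebius_function 0 (-z) (of_real t * u)" for t :: real
  define D where "D v = of_real (1 - (norm (-z))\<^sup>2) / (1 - cnj (-z) * v)\<^sup>2" for v :: complex
  have tu: "norm (of_real t * u) < 1" if "t \<in> {0..1}" for t
    using that u mult_left_le_one_le[of "norm u" t] by (simp add: norm_mult)
  have d: "(\<gamma> has_vector_derivative u * D (of_real t * u)) (at t)" if t: "t \<in> {0..1}" for t
  proof -
    have "((\<lambda>s. of_real s * u) has_vector_derivative u) (at t)"
      by (auto intro!: derivative_eq_intros)
    from field_vector_diff_chain_at[OF this] Moebius_function_deriv[OF mz tu[OF t]]
    show ?thesis unfolding \<gamma>_def D_def o_def by blast
  qed
  have "continuous_on {0..1} (\<lambda>t. u * D (of_real t * u))"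
    unfolding D_def using disc_denom_nonzero[OF mz tu] by (intro continuous_intros) auto
  then have C1: "\<gamma> C1_differentiable_on {0..1}"
    unfolding C1_differentiable_on_def
    by (intro exI[of _ "\<lambda>t. u * D (of_real t * u)"]) (simp add: d)
  have im: "\<gamma> ` {0..1} \<subseteq> unit_disc"
  proof
    fix v assume "v \<in> \<gamma> ` {0..1}"
    then obtain t where "t \<in> {0..1}" "v = \<gamma> t" by blast
    then show "v \<in> unit_disc"
      using Moebius_function_norm_lt_1[OF mz tu[of t]] by (simp add: \<gamma>_def)
  qed
  have g0: "\<gamma> 0 = z" by (simp add: \<gamma>_def Moebius_function_of_zero)
  have g1: "\<gamma> 1 = w"
    unfolding \<gamma>_def u_def using Moebius_function_compose[of "-z" z w] z w by simp
  define A where "A t = 2 * artanh (t * norm u)" for t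
  have "((\<lambda>t. 2 * norm (vector_derivative \<gamma> (at t)) / (1 - (norm (\<gamma> t))\<^sup>2)) has_integral A 1 - A 0) {0..1}"
  proof (rule fundamental_theorem_of_calculus)
    fix t :: real assume t: "t \<in> {0..1}"
    have l: "\<bar>t * norm u\<bar> < 1" using tu[OF t] by (simp add: norm_mult abs_mult)
    have "(A has_real_derivative 2 * (norm u / (1 - (t * norm u)\<^sup>2))) (at t within {0..1})"
    proof -
      have "((\<lambda>t. t * norm u) has_real_derivative norm u) (at t within {0..1})"
        by (auto intro!: derivative_eq_intros)
      from DERIV_cmult[OF DERIV_chain2[OF artanh_real_has_field_derivative[OF l] this], of 2]
      show ?thesis unfolding A_def by simp
    qed
    moreover have "2 * norm (vector_derivative \<gamma> (at t)) / (1 - (norm (\<gamma> t))\<^sup>2)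
        = 2 * (norm u / (1 - (t * norm u)\<^sup>2))"
    proof -
      have "2 * norm (vector_derivative \<gamma> (at t)) / (1 - (norm (\<gamma> t))\<^sup>2)
          = 2 * norm u * (norm (D (of_real t * u)) / (1 - (norm (\<gamma> t))\<^sup>2))"
        using vector_derivative_at[OF d[OF t]] by (simp add: norm_mult)
      also have "norm (D (of_real t * u)) / (1 - (norm (\<gamma> t))\<^sup>2) = 1 / (1 - (norm (of_real t * u))\<^sup>2)"
        unfolding D_def \<gamma>_def by (rule Moebius_function_isometry[OF mz tu[OF t]])
      finally show ?thesis by (simp add: norm_mult power_mult_distrib)
    qed
    ultimately show "(A has_vector_derivative
        2 * norm (vector_derivative \<gamma> (at t)) / (1 - (norm (\<gamma> t))\<^sup>2)) (at t within {0..1})"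
      by (simp add: has_real_derivative_iff_has_vector_derivative)
  qed simp
  then have "hyperbolic_length \<gamma> = 2 * artanh (norm u)"
    unfolding hyperbolic_length_def by (simp add: integral_unique A_def)
  then show thesis using that C1 im g0 g1 unfolding u_def by blast
qed

lemma hyperbolic_dist_eq_artanh:
  assumes "norm z < 1" "norm w < 1"
  shows "hyperbolic_dist z w = 2 * artanh (norm (Moebius_function 0 z w))"
  unfolding hyperbolic_dist_def
proof (rule cInf_eq_minimum)
  obtain \<gamma> where "\<gamma> C1_differentiable_on {0..1}" "\<gamma> ` {0..1} \<subseteq> unit_disc" "\<gamma> 0 = z" "\<gamma> 1 = w"
    "hyperbolic_length \<gamma> = 2 * artanh (norm (Moebius_function 0 z w))"
    using hyperbolic_length_attained[OF assms] by blast
  then show "2 * artanh (norm (Moebius_function 0 z w))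
    \<in> {hyperbolic_length \<gamma> |\<gamma>. \<gamma> C1_differentiable_on {0..1} \<and> \<gamma> ` {0..1} \<subseteq> unit_disc
            \<and> \<gamma> 0 = z \<and> \<gamma> 1 = w}"
    by (metis (mono_tags, lifting) mem_Collect_eq)
qed (use hyperbolic_length_ge in auto)

lemma sinh_artanh_real:
  assumes "0 \<le> r" "r < 1"
  shows "sinh (artanh r) = r / sqrt (1 - r\<^sup>2)"
proof -
  define s where "s = sqrt ((1 + r) / (1 - r))"
  have s: "s > 0" using assms by (simp add: s_def)
  have s2: "s\<^sup>2 = (1 + r) / (1 - r)" using assms by (simp add: s_def)
  have e: "exp (artanh r) = s"
    unfolding artanh_def s_def using assms by (simp add: ln_sqrt[symmetric])
  have "sinh (artanh r) = (s - 1 / s) / 2"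
    by (simp add: sinh_field_def e exp_minus inverse_eq_divide)
  also have "\<dots> = (s\<^sup>2 - 1) / (2 * s)"
    using s by (simp add: field_simps power2_eq_square)
  also have "\<dots> = r / ((1 - r) * s)"
    unfolding s2 using assms s by (simp add: field_simps)
  also have "(1 - r) * s = sqrt ((1 - r)\<^sup>2 * ((1 + r) / (1 - r)))"
    unfolding s_def real_sqrt_mult using assms by simp
  also have "(1 - r)\<^sup>2 * ((1 + r) / (1 - r)) = 1 - r\<^sup>2"
    using assms by (simp add: power2_eq_square field_simps)
  finally show ?thesis .
qed

theorem sinh_half_hyperbolic_dist:
  assumes "norm z < 1" "norm w < 1"
  shows "sinh (hyperbolic_dist z w / 2)
           = norm (z - w) / sqrt ((1 - (norm z)\<^sup>2) * (1 - (norm w)\<^sup>2))"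
proof -
  define r where "r = norm (Moebius_function 0 z w)"
  have r: "0 \<le> r" "r < 1" using Moebius_function_norm_lt_1[OF assms] by (simp_all add: r_def)
  have n: "norm (1 - cnj z * w) > 0" using disc_denom_nonzero[OF assms] by simp
  have "sinh (hyperbolic_dist z w / 2) = r / sqrt (1 - r\<^sup>2)"
    using hyperbolic_dist_eq_artanh[OF assms] sinh_artanh_real[OF r] by (simp add: r_def)
  also have "1 - r\<^sup>2 = (1 - (norm z)\<^sup>2) * (1 - (norm w)\<^sup>2) / (norm (1 - cnj z * w))\<^sup>2"
    unfolding r_def by (rule Moebius_function_norm_identity[OF assms])
  also have "sqrt \<dots> = sqrt ((1 - (norm z)\<^sup>2) * (1 - (norm w)\<^sup>2)) / norm (1 - cnj z * w)"
    by (simp add: real_sqrt_divide)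
  also have "r = norm (z - w) / norm (1 - cnj z * w)"
    by (simp add: r_def Moebius_function_simple norm_divide norm_minus_commute)
  finally show ?thesis using n by simp
qed

end

theory Submission
  imports Defs
begin

text \<open>
  The idea is that an elliptic \<open>f\<close> is a rotation in suitable coordinates. Choose an automorphism \<open>\<phi>\<close>
  of the disc with \<open>\<phi> \<circ> f = c \<phi>\<close>, \<open>\<bar>c\<bar> = 1\<close>, and put
  \<open>k\<^sub>n(w) = c\<^sup>-\<^sup>n \<phi>(f\<^sub>n(\<phi>\<inverse>(c\<^sup>n\<^sup>-\<^sup>1 w)))\<close>. Then \<open>f\<^sup>-\<^sup>n \<circ> F\<^sub>n\<close> is conjugate by \<open>\<phi>\<close> to
  \<open>G\<^sub>n = k\<^sub>n \<circ> \<dots> \<circ> k\<^sub>1\<close>, and the \<open>k\<^sub>n\<close> are self-maps of the disc that approach the identity.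
  Since rotations preserve every disc centred at 0, a bound for \<open>k\<^sub>n - id\<close> on such a disc is the same
  as a bound for \<open>h\<^sub>n - id\<close>, where \<open>h\<^sub>n = c\<^sup>-\<^sup>1 \<phi> \<circ> f\<^sub>n \<circ> \<phi>\<inverse>\<close>. The hypotheses say how little \<open>h\<^sub>n\<close>
  moves the two points \<open>\<phi>(a)\<close> and \<open>\<phi>(b)\<close>.

  By the Schwarz--Pick lemma a self-map that fixes two points is the identity. Lemma
  \<open>two_point_stability\<close> is a linear quantitative form: on \<open>\<bar>z\<bar> \<le> r\<close> the displacement of any self-map is
  at most a constant times the sum of its displacements at two fixed points. Hence
  \<open>\<Sum>\<^sub>n sup {\<bar>k\<^sub>n(w) - w\<bar> : \<bar>w\<bar> \<le> r}\<close> is finite for every \<open>r < 1\<close>.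

  For such a sequence \<open>k\<^sub>n\<close> (the locale \<open>near_identity\<close>) three things happen. The Schwarz--Pick
  lemma and \<open>\<Sum>\<^sub>n \<bar>k\<^sub>n(0)\<bar> < \<infinity>\<close> keep \<open>G\<^sub>n(z)\<close> in a disc \<open>\<bar>w\<bar> \<le> R < 1\<close> as long as \<open>\<bar>z\<bar> \<le> r\<close>
  (\<open>orbits_bounded\<close>). Therefore \<open>\<Sum>\<^sub>n \<bar>G\<^sub>n\<^sub>+\<^sub>1 - G\<^sub>n\<bar>\<close> converges uniformly there (\<open>converges\<close>).
  Finally, by Cauchy's estimate \<open>k\<^sub>n - id\<close> has a summable sequence of Lipschitz constants, so that from some index
  on each step shrinks the distance of two orbits by a factor at least \<open>1 - y\<^sub>n\<close>, with
  \<open>\<Prod>\<^sub>n (1 - y\<^sub>n) > 0\<close>; two points separated by an early \<open>G\<^sub>N\<close> stay separated in the limit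
  (\<open>limit_not_constant\<close>).
\<close>

section \<open>Self-maps and Moebius transformations of the disc\<close>

abbreviation M :: "complex \<Rightarrow> complex \<Rightarrow> complex" where
  "M \<equiv> Moebius_function 0"

lemma disc_self_map_norm: "disc_self_map h \<Longrightarrow> norm z < 1 \<Longrightarrow> norm (h z) < 1"
  by (auto simp: disc_self_map_def image_subset_iff)

lemma disc_self_map_compose:
  assumes "disc_self_map g" "disc_self_map h"
  shows "disc_self_map (g \<circ> h)"
  using assms holomorphic_on_compose_gen[of h unit_disc g unit_disc]
  by (auto simp: disc_self_map_def image_subset_iff)

lemma disc_self_map_Moebius: "norm a < 1 \<Longrightarrow> disc_self_map (M a)"
  by (auto simp: disc_self_map_def Moebius_function_holomorphic Moebius_function_norm_lt_1)

lemma norm_Moebius_denom: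
  assumes "norm a < 1" "norm z < 1"
  shows "1 - norm a \<le> norm (1 - cnj a * z)" "norm (1 - cnj a * z) \<le> 2"
proof -
  have l: "norm (cnj a * z) \<le> norm a"
    using assms by (simp add: norm_mult mult_left_le)
  then show "1 - norm a \<le> norm (1 - cnj a * z)"
    using norm_triangle_ineq2[of 1 "cnj a * z"] by simp
  show "norm (1 - cnj a * z) \<le> 2"
    using norm_triangle_ineq4[of 1 "cnj a * z"] l assms by simp
qed

lemma Moebius_diff:
  assumes "norm a < 1" "norm u < 1" "norm v < 1"
  shows "M a u - M a v = (u - v) * of_real (1 - (norm a)\<^sup>2) / ((1 - cnj a * u) * (1 - cnj a * v))"
proof -
  have e: "of_real (1 - (norm a)\<^sup>2) = 1 - cnj a * a"
    using complex_norm_square[of a] by (simp add: mult.commute)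
  show ?thesis
    unfolding e Moebius_function_simple
    using disc_denom_nonzero[OF assms(1,2)] disc_denom_nonzero[OF assms(1,3)]
    by (simp add: field_simps)
qed

text \<open>
  On the disc \<open>M a\<close> is bi-Lipschitz for the Euclidean metric, because both factors of the denominator
  in the difference formula lie between \<open>1 - \<bar>a\<bar>\<close> and 2. Errors can thus be moved between the
  coordinates \<open>z\<close> and \<open>M a z\<close>.
\<close>
lemma norm_Moebius_diff:
  assumes "norm a < 1" "norm u < 1" "norm v < 1"
  shows "norm (M a u - M a v) \<le> 2 * norm (u - v) / (1 - norm a)\<^sup>2"
    and "norm (u - v) \<le> 4 * norm (M a u - M a v) / (1 - (norm a)\<^sup>2)"
proof -
  define P where "P = norm (1 - cnj a * u) * norm (1 - cnj a * v)"
  have d: "1 - (norm a)\<^sup>2 > 0" using assms by (simp add: abs_square_less_1)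
  have eq: "norm (M a u - M a v) = norm (u - v) * (1 - (norm a)\<^sup>2) / P"
    unfolding Moebius_diff[OF assms] P_def norm_mult norm_divide norm_of_real
    using d by simp
  have P: "(1 - norm a)\<^sup>2 \<le> P" "P \<le> 4"
    using mult_mono[OF norm_Moebius_denom(1)[OF assms(1,2)] norm_Moebius_denom(1)[OF assms(1,3)]]
      mult_mono[OF norm_Moebius_denom(2)[OF assms(1,2)] norm_Moebius_denom(2)[OF assms(1,3)]] assms
    by (auto simp: P_def power2_eq_square)
  have pos: "(1 - norm a)\<^sup>2 > 0" using assms by simp
  have "norm (u - v) * (1 - (norm a)\<^sup>2) / P \<le> norm (u - v) * 2 / (1 - norm a)\<^sup>2"
    using P(1) pos d by (intro frac_le mult_left_mono) (auto intro: order.trans[OF _ zero_le_power2])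
  then show "norm (M a u - M a v) \<le> 2 * norm (u - v) / (1 - norm a)\<^sup>2"
    unfolding eq by (simp add: mult.commute)
  have "norm (u - v) = norm (M a u - M a v) * P / (1 - (norm a)\<^sup>2)"
    unfolding eq using d less_le_trans[OF pos P(1)] by (simp del: zero_less_power2)
  also have "\<dots> \<le> 4 * norm (M a u - M a v) / (1 - (norm a)\<^sup>2)"
    using mult_right_mono[OF P(2), of "norm (M a u - M a v)"] d
    by (intro divide_right_mono) (auto simp: mult.commute)
  finally show "norm (u - v) \<le> 4 * norm (M a u - M a v) / (1 - (norm a)\<^sup>2)" .
qed

text \<open>
  After the common denominator is cleared, the numerator of \<open>M \<alpha> u - M a u\<close> is a combination of
  \<open>\<alpha> - a\<close> and its conjugate with coefficients of total size at most 4.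
\<close>
lemma norm_Moebius_diff_centre:
  assumes a: "norm a < 1" and al: "norm \<alpha> < 1" and u: "norm u < 1"
  shows "norm (M \<alpha> u - M a u) \<le> 4 * norm (\<alpha> - a) / ((1 - norm \<alpha>) * (1 - norm a))"
proof -
  define N where "N = (a - \<alpha>) + cnj (\<alpha> - a) * u\<^sup>2 + ((\<alpha> - a) * cnj a - a * cnj (\<alpha> - a)) * u"
  have "M \<alpha> u - M a u = N / ((1 - cnj \<alpha> * u) * (1 - cnj a * u))"
    unfolding Moebius_function_simple N_def
    using disc_denom_nonzero[OF al u] disc_denom_nonzero[OF a u]
    by (simp add: field_simps power2_eq_square)
  then have eq: "norm (M \<alpha> u - M a u) = norm N / (norm (1 - cnj \<alpha> * u) * norm (1 - cnj a * u))"
    by (simp only: norm_divide norm_mult)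
  have s: "x * y \<le> x" if "0 \<le> x" "y \<le> 1" for x y :: real
    using mult_left_mono[OF that(2,1)] by simp
  have 1: "norm (cnj (\<alpha> - a) * u\<^sup>2) \<le> norm (\<alpha> - a)"
    unfolding norm_mult complex_mod_cnj norm_power using u by (intro s) (auto simp: power_le_one)
  have "norm ((\<alpha> - a) * cnj a - a * cnj (\<alpha> - a)) \<le> norm ((\<alpha> - a) * cnj a) + norm (a * cnj (\<alpha> - a))"
    by (rule norm_triangle_ineq4)
  also have "\<dots> \<le> 2 * norm (\<alpha> - a)"
    unfolding norm_mult complex_mod_cnj
    using s[of "norm (\<alpha> - a)" "norm a"] a by (simp add: mult.commute)
  finally have 2: "norm (((\<alpha> - a) * cnj a - a * cnj (\<alpha> - a)) * u) \<le> 2 * norm (\<alpha> - a)"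
    unfolding norm_mult[of _ u] using s[of _ "norm u"] u by (meson norm_ge_zero less_imp_le order.trans)
  have "norm N \<le> 4 * norm (\<alpha> - a)"
    unfolding N_def
    by (rule order.trans[OF norm_triangle_ineq] order.trans[OF add_mono[OF norm_triangle_ineq 2]])+
      (use 1 in \<open>simp add: norm_minus_commute\<close>)
  then show ?thesis
    unfolding eq using norm_Moebius_denom(1)[OF al u] norm_Moebius_denom(1)[OF a u] a al
    by (intro frac_le mult_mono) auto
qed

text \<open>
  The Schwarz lemma applies to \<open>M (h a) \<circ> h \<circ> M (-a)\<close>, which fixes 0.
\<close>
lemma Schwarz_Pick:
  assumes h: "disc_self_map h" and a: "norm a < 1" and z: "norm z < 1"
  shows "norm (M (h a) (h z)) \<le> norm (M a z)"
proof -
  define F where "F = M (h a) \<circ> (h \<circ> M (- a))"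
  have F: "disc_self_map F"
    unfolding F_def using disc_self_map_norm[OF h a] a h
    by (intro disc_self_map_compose disc_self_map_Moebius) auto
  have "F 0 = 0"
    by (simp add: F_def Moebius_function_of_zero Moebius_function_eq_zero)
  then have "norm (F (M a z)) \<le> norm (M a z)"
    using F Moebius_function_norm_lt_1[OF a z]
    by (intro Schwarz_Lemma(1)) (auto simp: disc_self_map_def intro: disc_self_map_norm[OF F])
  then show ?thesis
    using Moebius_function_compose[of "- a" a z] a z by (simp add: F_def)
qed

lemma one_minus_norm_Moebius_sq_ge:
  assumes "norm a < 1" "norm z < 1"
  shows "(1 - (norm a)\<^sup>2) * (1 - (norm z)\<^sup>2) / 4 \<le> 1 - (norm (M a z))\<^sup>2"
proof -
  have p: "1 - (norm a)\<^sup>2 > 0" "1 - (norm z)\<^sup>2 > 0" using assms by (simp_all add: abs_square_less_1)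
  have "(norm (1 - cnj a * z))\<^sup>2 \<le> 2\<^sup>2"
    by (intro power_mono norm_Moebius_denom assms) auto
  then show ?thesis
    unfolding Moebius_function_norm_identity[OF assms]
    using p disc_denom_nonzero[OF assms] by (intro frac_le) auto
qed

section \<open>Displacement of a self-map that nearly fixes two points\<close>

text \<open>
  Write \<open>F z = z q(z)\<close>. By the Schwarz lemma \<open>q\<close> is a unimodular constant or a self-map of the disc. In
  the second case the Schwarz--Pick lemma, applied to \<open>q\<close> at \<open>\<beta>\<close> and \<open>\<xi>\<close>, gives the Harnack-type
  inequality \<open>\<bar>1 - q(\<xi>)\<bar> \<le> \<bar>1 - q(\<beta>)\<bar> (1 + \<sigma>) / (1 - \<sigma>)\<close> with \<open>\<sigma> = \<bar>M \<beta> \<xi>\<bar>\<close>: if \<open>q\<close> is near 1 at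
  one point, then it is near 1 on compact sets, with linear dependence on the error.
\<close>
lemma Schwarz_stability:
  assumes F: "disc_self_map F" "F 0 = 0" and b: "norm \<beta> < 1" "\<beta> \<noteq> 0" and x: "norm \<xi> < 1"
  shows "norm (F \<xi> - \<xi>)
           \<le> 16 * norm (F \<beta> - \<beta>) / (norm \<beta> * ((1 - (norm \<beta>)\<^sup>2) * (1 - (norm \<xi>)\<^sup>2)))"
proof -
  have hol: "F holomorphic_on ball 0 1" using F by (simp add: disc_self_map_def)
  note lt = disc_self_map_norm[OF F(1)]
  have sq: "1 - (norm \<beta>)\<^sup>2 > 0" "1 - (norm \<xi>)\<^sup>2 > 0"
    using b x by (simp_all add: abs_square_less_1)
  have sq1: "(1 - (norm \<beta>)\<^sup>2) * (1 - (norm \<xi>)\<^sup>2) \<le> 1"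
    using sq by (intro mult_le_one) auto
  obtain q where q: "q holomorphic_on ball 0 1"
    and Fq: "\<And>z. norm z < 1 \<Longrightarrow> F z = z * q z" and q0: "deriv F 0 = q 0"
    using Schwarz3[OF hol F(2)] by blast
  define p where "p z = q z - 1" for z
  have Fp: "F z - z = z * p z" if "norm z < 1" for z
    using Fq[OF that] by (simp add: p_def algebra_simps)
  have pb: "norm (F \<beta> - \<beta>) / norm \<beta> = norm (p \<beta>)"
    using b by (simp add: Fp norm_mult)
  have key: "norm (p \<xi>) \<le> 16 * norm (p \<beta>) / ((1 - (norm \<beta>)\<^sup>2) * (1 - (norm \<xi>)\<^sup>2))"
  proof (cases "(\<exists>z. norm z < 1 \<and> z \<noteq> 0 \<and> norm (F z) = norm z) \<or> norm (deriv F 0) = 1")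
    case True
    have "\<exists>\<alpha>. (\<forall>z. norm z < 1 \<longrightarrow> F z = \<alpha> * z) \<and> norm \<alpha> = 1"
      by (rule Schwarz_Lemma(3)[OF hol F(2) lt x True])
    then obtain \<alpha> where \<alpha>: "\<And>z. norm z < 1 \<Longrightarrow> F z = \<alpha> * z" by blast
    have pa: "p z = \<alpha> - 1" if "norm z < 1" "z \<noteq> 0" for z
      using \<alpha>[OF that(1)] Fq[OF that(1)] that(2) by (simp add: p_def)
    have "p 0 = \<alpha> - 1"
    proof -
      have "q 0 = \<alpha>"
      proof (rule analytic_continuation_open[of "ball 0 1 - {0}" "ball 0 1" q "\<lambda>_. \<alpha>"])
        show "ball 0 1 - {0} \<noteq> ({}::complex set)" using b by force
      qed (use q pa in \<open>auto simp: p_def\<close>)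
      then show ?thesis by (simp add: p_def)
    qed
    with pa b x have "p \<xi> = p \<beta>" by (cases "\<xi> = 0") auto
    moreover have "norm (p \<beta>) * ((1 - (norm \<beta>)\<^sup>2) * (1 - (norm \<xi>)\<^sup>2)) \<le> 16 * norm (p \<beta>)"
      using order.trans[OF mult_left_mono[OF sq1, of "norm (p \<beta>)"]] by simp
    ultimately show ?thesis
      using sq by (simp add: pos_le_divide_eq)
  next
    case False
    have qlt: "norm (q z) < 1" if z: "norm z < 1" for z
    proof (cases "z = 0")
      case True
      then show ?thesis using Schwarz_Lemma(2)[OF hol F(2) lt x] False q0 by force
    next
      case nz: False
      then have "norm (F z) < norm z"
        using Schwarz_Lemma(1)[OF hol F(2) lt z] False z by force
      then show ?thesis using nz Fq[OF z] by (simp add: norm_mult)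
    qed
    then have qs: "disc_self_map q" using q by (auto simp: disc_self_map_def)
    define \<sigma> where "\<sigma> = norm (M \<beta> \<xi>)"
    have s: "0 \<le> \<sigma>" "\<sigma> < 1" using Moebius_function_norm_lt_1[OF b(1) x] by (auto simp: \<sigma>_def)
    have "norm (M (q \<beta>) (q \<xi>)) \<le> \<sigma>"
      unfolding \<sigma>_def by (rule Schwarz_Pick[OF qs b(1) x])
    moreover have nz: "1 - cnj (q \<beta>) * q \<xi> \<noteq> 0"
      using qlt b x by (intro disc_denom_nonzero) auto
    ultimately have "norm (p \<xi> - p \<beta>) \<le> \<sigma> * norm (1 - cnj (q \<beta>) * q \<xi>)"
      by (simp add: Moebius_function_simple norm_divide field_simps p_def)
    \<comment> \<open>Both \<open>q \<beta>\<close> and \<open>q \<xi>\<close> are near 1, so the denominator is itself small, at most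
      \<open>\<bar>p \<beta>\<bar> + \<bar>p \<xi>\<bar>\<close>. This is what makes the estimate linear.\<close>
    also have "1 - cnj (q \<beta>) * q \<xi> = - cnj (p \<beta>) * q \<xi> - p \<xi>"
      by (simp add: p_def algebra_simps)
    also have "norm \<dots> \<le> norm (p \<beta>) + norm (p \<xi>)"
      using norm_triangle_ineq4[of "- cnj (p \<beta>) * q \<xi>" "p \<xi>"]
        mult_left_mono[OF less_imp_le[OF qlt[OF x]], of "norm (p \<beta>)"]
      by (simp add: norm_mult)
    finally have "norm (p \<xi>) - norm (p \<beta>) \<le> \<sigma> * (norm (p \<beta>) + norm (p \<xi>))"
      using s norm_triangle_ineq2[of "p \<xi>" "p \<beta>"] by (meson mult_left_mono order.trans)
    then have "norm (p \<xi>) * (1 - \<sigma>) \<le> norm (p \<beta>) * (1 + \<sigma>)" by (simp add: algebra_simps)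
    then have "norm (p \<xi>) * (1 - \<sigma>) * (1 + \<sigma>) \<le> norm (p \<beta>) * (1 + \<sigma>) * (1 + \<sigma>)"
      using s by (intro mult_right_mono) auto
    also have "\<dots> \<le> norm (p \<beta>) * 2 * 2" using s by (intro mult_mono) auto
    finally have "norm (p \<xi>) * (1 - \<sigma>\<^sup>2) \<le> 4 * norm (p \<beta>)"
      by (simp add: power2_eq_square algebra_simps)
    moreover have "(1 - (norm \<beta>)\<^sup>2) * (1 - (norm \<xi>)\<^sup>2) / 4 \<le> 1 - \<sigma>\<^sup>2"
      unfolding \<sigma>_def by (rule one_minus_norm_Moebius_sq_ge[OF b(1) x])
    ultimately have "norm (p \<xi>) * ((1 - (norm \<beta>)\<^sup>2) * (1 - (norm \<xi>)\<^sup>2) / 4) \<le> 4 * norm (p \<beta>)"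
      by (meson mult_left_mono norm_ge_zero order.trans)
    then show ?thesis using sq by (simp add: pos_le_divide_eq)
  qed
  have "norm (F \<xi> - \<xi>) \<le> norm (p \<xi>)"
    using x by (simp add: Fp norm_mult mult_left_le_one_le)
  also note key
  also have "16 * norm (p \<beta>) / ((1 - (norm \<beta>)\<^sup>2) * (1 - (norm \<xi>)\<^sup>2)) =
    16 * norm (F \<beta> - \<beta>) / (norm \<beta> * ((1 - (norm \<beta>)\<^sup>2) * (1 - (norm \<xi>)\<^sup>2)))"
    unfolding pb[symmetric] by simp
  finally show ?thesis .
qed

text \<open>
  The point \<open>a\<close> and its image \<open>\<alpha> = h a\<close> are both moved to 0: the map \<open>F\<close> with \<open>F (M a z) = M \<alpha> (h z)\<close>
  fixes 0 and nearly fixes \<open>M a b\<close>, so \<open>Schwarz_stability\<close> bounds its displacement at \<open>M a z\<close>.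
  Replacing \<open>M \<alpha>\<close> by \<open>M a\<close> costs a multiple of \<open>\<bar>\<alpha> - a\<bar>\<close>, provided that \<open>\<alpha>\<close> stays away from the
  unit circle; if it does not, the sum of displacements has a positive lower bound and the claim is trivial.
\<close>
lemma two_point_stability:
  assumes a: "norm a < 1" and b: "norm b < 1" and ne: "a \<noteq> b" and r: "r < 1"
  obtains C where "\<And>h z. disc_self_map h \<Longrightarrow> norm z \<le> r \<Longrightarrow>
    norm (h z - z) \<le> C * (norm (h a - a) + norm (h b - b))"
proof (cases "r \<ge> 0")
  case False
  then have "\<not> norm (z::complex) \<le> r" for z using norm_ge_zero[of z] by linarith
  then show ?thesis using that by blast
next
  case r0: True
  define \<beta> where "\<beta> = M a b"
  define A where "A = 1 - (norm a)\<^sup>2"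
  define B where "B = norm \<beta> * (1 - (norm \<beta>)\<^sup>2)"
  define E where "E = 8 / (1 - norm a)\<^sup>2"
  define W where "W = A * (1 - r\<^sup>2) / 4"
  define C where "C = 4 / (1 - norm a) + 4 / A * (E + 16 * E / (B * W))"
  have \<beta>: "norm \<beta> < 1" "\<beta> \<noteq> 0"
    unfolding \<beta>_def
    using Moebius_function_norm_lt_1[OF a b] disc_denom_nonzero[OF a b] ne
    by (blast, simp add: Moebius_function_simple)
  have A: "A > 0" using a by (simp add: A_def abs_square_less_1)
  have B: "B > 0" using \<beta> by (simp add: B_def abs_square_less_1)
  have E: "E > 0" using a by (simp add: E_def)
  have W: "W > 0" using A r r0 by (simp add: W_def abs_square_less_1)
  show ?thesis
  proof (rule that[of C])
    fix h z assume h: "disc_self_map h" and zr: "norm (z::complex) \<le> r"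
    define \<epsilon> where "\<epsilon> = norm (h a - a) + norm (h b - b)"
    have e0: "\<epsilon> \<ge> 0" by (simp add: \<epsilon>_def)
    have z: "norm z < 1" using zr r by simp
    note lt = disc_self_map_norm[OF h]
    show "norm (h z - z) \<le> C * (norm (h a - a) + norm (h b - b))"
      unfolding \<epsilon>_def[symmetric]
    proof (cases "norm (h a - a) \<ge> (1 - norm a) / 2")
      case True
      have "norm (h z - z) \<le> 2"
        using norm_triangle_ineq4[of "h z" z] lt[OF z] z by simp
      also have "2 \<le> 4 / (1 - norm a) * \<epsilon>"
      proof -
        have "\<epsilon> \<ge> (1 - norm a) / 2" using True norm_ge_zero[of "h b - b"] unfolding \<epsilon>_def by linarith
        then show ?thesis using a by (simp add: pos_le_divide_eq)
      qed
      also have "\<dots> \<le> C * \<epsilon>"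
        unfolding C_def using A B E W e0 by (intro mult_right_mono) auto
      finally show "norm (h z - z) \<le> C * \<epsilon>" .
    next
      case False
      define \<alpha> where "\<alpha> = h a"
      have \<alpha>: "norm \<alpha> < 1" using lt[OF a] by (simp add: \<alpha>_def)
      have "norm \<alpha> \<le> norm a + norm (h a - a)"
        unfolding \<alpha>_def by (metis norm_triangle_sub)
      then have al: "(1 - norm a) / 2 \<le> 1 - norm \<alpha>"
        using False by (simp add: field_simps)
      have centre: "norm (M \<alpha> u - M a u) \<le> E * norm (h a - a)" if u: "norm u < 1" for u
      proof -
        have "norm (M \<alpha> u - M a u) \<le> 4 * norm (\<alpha> - a) / ((1 - norm \<alpha>) * (1 - norm a))"
          by (rule norm_Moebius_diff_centre[OF a \<alpha> u])
        also have "\<dots> \<le> 4 * norm (\<alpha> - a) / ((1 - norm a) / 2 * (1 - norm a))"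
          using a al by (intro divide_left_mono mult_right_mono mult_pos_pos) (auto simp: \<alpha>)
        also have "\<dots> = E * norm (h a - a)"
          by (simp add: E_def \<alpha>_def power2_eq_square)
        finally show ?thesis .
      qed
      define F where "F = M \<alpha> \<circ> (h \<circ> M (- a))"
      have FM: "F (M a u) = M \<alpha> (h u)" if "norm u < 1" for u
        using Moebius_function_compose[of "- a" a u] a that by (simp add: F_def)
      have F: "disc_self_map F"
        unfolding F_def using a \<alpha> h by (intro disc_self_map_compose disc_self_map_Moebius) auto
      have F0: "F 0 = 0"
        by (simp add: F_def \<alpha>_def Moebius_function_of_zero Moebius_function_eq_zero)
      have "norm (F \<beta> - \<beta>) \<le> norm (M \<alpha> (h b) - M a (h b)) + norm (M a (h b) - M a b)"
        unfolding \<beta>_def FM[OF b] using norm_triangle_ineq[of "M \<alpha> (h b) - M a (h b)" "M a (h b) - M a b"]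
        by simp
      also have "\<dots> \<le> E * norm (h a - a) + E * norm (h b - b)"
      proof (rule add_mono[OF centre[OF lt[OF b]]])
        have "norm (M a (h b) - M a b) \<le> 2 * norm (h b - b) / (1 - norm a)\<^sup>2"
          by (rule norm_Moebius_diff(1)[OF a lt[OF b] b])
        also have "\<dots> \<le> E * norm (h b - b)"
          unfolding E_def by (simp add: divide_right_mono)
        finally show "norm (M a (h b) - M a b) \<le> E * norm (h b - b)" .
      qed
      finally have Fb: "norm (F \<beta> - \<beta>) \<le> E * \<epsilon>" by (simp add: \<epsilon>_def distrib_left)
      have xi: "norm (M a z) < 1" by (rule Moebius_function_norm_lt_1[OF a z])
      have "W \<le> A * (1 - (norm z)\<^sup>2) / 4"
        unfolding W_def using A zr by (intro divide_right_mono mult_left_mono) (auto intro: power_mono)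
      also have "\<dots> \<le> 1 - (norm (M a z))\<^sup>2"
        unfolding A_def by (rule one_minus_norm_Moebius_sq_ge[OF a z])
      finally have Wx: "W \<le> 1 - (norm (M a z))\<^sup>2" .
      have "norm (F (M a z) - M a z) \<le> 16 * norm (F \<beta> - \<beta>) / (B * (1 - (norm (M a z))\<^sup>2))"
        using Schwarz_stability[OF F F0 \<beta> xi] by (simp add: B_def mult.assoc)
      also have "\<dots> \<le> 16 * (E * \<epsilon>) / (B * W)"
        using B W Wx Fb E e0 by (intro frac_le mult_left_mono) auto
      finally have "norm (M \<alpha> (h z) - M a z) \<le> 16 * E / (B * W) * \<epsilon>"
        unfolding FM[OF z] by simp
      moreover have "norm (M \<alpha> (h z) - M a (h z)) \<le> E * \<epsilon>"
        using order.trans[OF centre[OF lt[OF z]] mult_left_mono[of "norm (h a - a)" \<epsilon> E]] E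
        by (simp add: \<epsilon>_def)
      ultimately have d: "norm (M a (h z) - M a z) \<le> (E + 16 * E / (B * W)) * \<epsilon>"
        using norm_triangle_ineq4[of "M \<alpha> (h z) - M a z" "M \<alpha> (h z) - M a (h z)"]
        by (simp add: distrib_right)
      have "norm (h z - z) \<le> 4 * norm (M a (h z) - M a z) / A"
        unfolding A_def by (rule norm_Moebius_diff(2)[OF a lt[OF z] z])
      also have "\<dots> \<le> 4 * ((E + 16 * E / (B * W)) * \<epsilon>) / A"
        using d A by (intro divide_right_mono) auto
      also have "\<dots> = 4 / A * (E + 16 * E / (B * W)) * \<epsilon>" by simp
      also have "\<dots> \<le> C * \<epsilon>"
        unfolding C_def using a e0 by (intro mult_right_mono) auto
      finally show "norm (h z - z) \<le> C * \<epsilon>" .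
    qed
  qed
qed

section \<open>Products and recursive lower bounds\<close>

lemma prod_one_minus_bounded_below:
  fixes x :: "nat \<Rightarrow> real"
  assumes x: "\<And>n. 0 \<le> x n" "\<And>n. x n < 1" and sx: "summable x"
  shows "\<exists>P>0. \<forall>n. P \<le> (\<Prod>i<n. 1 - x i)"
proof -
  have "abs_convergent_prod (\<lambda>n. 1 - x n)"
    by (rule summable_imp_abs_convergent_prod) (use x sx in simp)
  then have c: "convergent_prod (\<lambda>n. 1 - x n)" by (rule abs_convergent_prod_imp_convergent_prod)
  have "decseq (\<lambda>n. \<Prod>i<n. 1 - x i)"
  proof (rule decseq_SucI)
    fix n
    have "0 \<le> (\<Prod>i<n. 1 - x i)" using x by (intro prod_nonneg) (auto intro: less_imp_le)
    then show "(\<Prod>i<Suc n. 1 - x i) \<le> (\<Prod>i<n. 1 - x i)"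
      using x by (simp add: mult_left_le)
  qed
  moreover have "(\<lambda>n. \<Prod>i<n. 1 - x i) \<longlonglongrightarrow> prodinf (\<lambda>n. 1 - x n)"
    using convergent_prod_LIMSEQ[OF c] LIMSEQ_lessThan_iff_atMost[of "prod (\<lambda>n. 1 - x n)"] by simp
  ultimately have "prodinf (\<lambda>n. 1 - x n) \<le> (\<Prod>i<n. 1 - x i)" for n
    by (rule decseq_ge)
  moreover have "prodinf (\<lambda>n. 1 - x n) > 0"
    using x by (intro less_0_prodinf c) simp
  ultimately show ?thesis by blast
qed

lemma recursive_lower_bound:
  fixes x u :: "nat \<Rightarrow> real"
  assumes "\<And>n. (1 - x n) * u n \<le> u (Suc n)" "\<And>n. x n < 1"
  shows "(\<Prod>i<n. 1 - x i) * u 0 \<le> u n"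
proof (induction n)
  case (Suc n)
  have "(\<Prod>i<Suc n. 1 - x i) * u 0 = (1 - x n) * ((\<Prod>i<n. 1 - x i) * u 0)" by simp
  also have "\<dots> \<le> (1 - x n) * u n"
    using Suc assms(2)[of n] by (intro mult_left_mono) auto
  also have "\<dots> \<le> u (Suc n)" by (rule assms(1))
  finally show ?case .
qed simp

section \<open>Compositions of self-maps\<close>

lemma disc_self_map_left_comp:
  assumes "\<And>n. n \<ge> 1 \<Longrightarrow> disc_self_map (k n)"
  shows "disc_self_map (left_comp k n)"
proof (induction n)
  case 0
  then show ?case by (simp add: disc_self_map_def)
next
  case (Suc n)
  show ?case
    unfolding left_comp.simps by (rule disc_self_map_compose[OF assms Suc]) simp
qed

text \<open>
  By the open mapping theorem \<open>left_comp k n\<close> maps \<open>U\<close> onto an open set, and the next map, being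
  non-constant on the disc, is non-constant on every nonempty open subset.
\<close>
lemma left_comp_not_constant_on:
  assumes k: "\<And>n. n \<ge> 1 \<Longrightarrow> disc_self_map (k n)"
    and nc: "\<And>n. n \<ge> 1 \<Longrightarrow> \<not> k n constant_on unit_disc"
    and U: "open U" "connected U" "U \<noteq> {}" "U \<subseteq> unit_disc"
  shows "\<not> left_comp k n constant_on U"
proof (induction n)
  case 0
  have "\<not> (id :: complex \<Rightarrow> complex) constant_on U"
    using injective_not_constant[OF U(1) inj_on_id] U(3) by blast
  then show ?case unfolding left_comp.simps .
next
  case (Suc n)
  let ?F = "left_comp k n"
  have F: "disc_self_map ?F" by (rule disc_self_map_left_comp[OF k])
  have "?F holomorphic_on U"
    using F U(4) by (auto simp: disc_self_map_def intro: holomorphic_on_subset)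
  then have op: "open (?F ` U)"
    using open_mapping_thm[of ?F U U] U Suc by blast
  have sub: "?F ` U \<subseteq> unit_disc"
    using F U(4) by (auto simp: disc_self_map_def)
  obtain w where w: "w \<in> ?F ` U" using U(3) by blast
  show ?case
  proof
    assume "left_comp k (Suc n) constant_on U"
    then have "k (Suc n) constant_on ?F ` U"
      by (auto simp: constant_on_def)
    moreover have "w islimpt ?F ` U"
      using w op by (intro interior_limit_point) (simp add: interior_open)
    ultimately have "k (Suc n) constant_on unit_disc"
      using k[of "Suc n"] sub w
      by (intro analytic_continuation'[of "k (Suc n)" unit_disc "?F ` U" w])
        (auto simp: disc_self_map_def)
    then show False using nc[of "Suc n"] by simp
  qed
qed

text \<open>
  The factor is \<open>(1 - \<bar>k 0\<bar>) / (1 + \<bar>k 0\<bar>)\<close>. The inequality is a substitute for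
  \<open>\<rho>(k w, 0) \<le> \<rho>(w, 0) + \<rho>(k 0, 0)\<close> for the quantity \<open>1 - \<bar>w\<bar>\<^sup>2\<close>. Its factor depends
  only on the displacement at 0, so that it can be iterated along an orbit without knowing where the orbit is.
\<close>
lemma one_minus_norm_self_map_ge:
  assumes k: "disc_self_map k" and w: "norm w < 1"
  shows "(1 - 2 * norm (k 0) / (1 + norm (k 0))) * (1 - (norm w)\<^sup>2) \<le> 1 - (norm (k w))\<^sup>2"
proof -
  define \<alpha> v where "\<alpha> = k 0" and "v = k w"
  have lt: "norm \<alpha> < 1" "norm v < 1"
    using disc_self_map_norm[OF k] w by (auto simp: \<alpha>_def v_def)
  have sq: "1 - (norm w)\<^sup>2 > 0" "1 - (norm \<alpha>)\<^sup>2 > 0"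
    using w lt by (simp_all add: abs_square_less_1)
  define d where "d = norm (1 - cnj \<alpha> * v)"
  have d: "1 - norm \<alpha> \<le> d" unfolding d_def by (rule norm_Moebius_denom(1)[OF lt])
  then have d0: "d > 0" using lt by simp
  have "norm (M \<alpha> v) \<le> norm w"
    using Schwarz_Pick[OF k _ w, of 0] by (simp add: \<alpha>_def v_def Moebius_function_simple)
  then have "1 - (norm w)\<^sup>2 \<le> 1 - (norm (M \<alpha> v))\<^sup>2"
    by (simp add: power_mono)
  also have "\<dots> = (1 - (norm \<alpha>)\<^sup>2) * (1 - (norm v)\<^sup>2) / d\<^sup>2"
    unfolding d_def by (rule Moebius_function_norm_identity[OF lt])
  finally have "(1 - (norm w)\<^sup>2) * d\<^sup>2 \<le> (1 - (norm \<alpha>)\<^sup>2) * (1 - (norm v)\<^sup>2)"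
    using d0 by (simp add: pos_le_divide_eq)
  moreover have "(1 - (norm w)\<^sup>2) * (1 - norm \<alpha>)\<^sup>2 \<le> (1 - (norm w)\<^sup>2) * d\<^sup>2"
    using sq d lt by (intro mult_left_mono power_mono) auto
  ultimately have "(1 - norm \<alpha>) * ((1 - norm \<alpha>) * (1 - (norm w)\<^sup>2))
      \<le> (1 - norm \<alpha>) * ((1 + norm \<alpha>) * (1 - (norm v)\<^sup>2))"
    by (simp add: power2_eq_square algebra_simps)
  then have "(1 - norm \<alpha>) * (1 - (norm w)\<^sup>2) \<le> (1 + norm \<alpha>) * (1 - (norm v)\<^sup>2)"
    using lt by simp
  moreover have p: "1 + norm \<alpha> > 0" by (simp add: add_pos_nonneg)
  ultimately have "(1 - norm \<alpha>) * (1 - (norm w)\<^sup>2) / (1 + norm \<alpha>) \<le> 1 - (norm v)\<^sup>2"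
    by (simp add: pos_divide_le_eq mult.commute)
  moreover have "1 - 2 * norm \<alpha> / (1 + norm \<alpha>) = (1 - norm \<alpha>) / (1 + norm \<alpha>)"
    using p by (simp add: field_simps)
  ultimately show ?thesis by (simp add: \<alpha>_def v_def)
qed

text \<open>Cauchy's estimate on discs of radius \<open>S - R\<close> bounds the derivative on \<open>cball 0 R\<close>.\<close>
lemma Lipschitz_of_bounded_holomorphic:
  assumes f: "f holomorphic_on unit_disc" and R: "R < S" "S < 1"
    and bd: "\<And>z. norm z \<le> S \<Longrightarrow> norm (f z) \<le> B"
    and u: "norm u \<le> R" and v: "norm v \<le> R"
  shows "norm (f u - f v) \<le> B / (S - R) * norm (u - v)"
proof (rule field_differentiable_bound[of "cball 0 R" f "deriv f"])
  fix z :: complex assume z: "z \<in> cball 0 R"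
  have near: "norm y \<le> S" if "norm (y - z) \<le> S - R" for y
    using norm_triangle_ineq[of "y - z" z] that z by simp
  have sub: "cball z (S - R) \<subseteq> unit_disc"
  proof
    fix y assume "y \<in> cball z (S - R)"
    then have "norm y \<le> S" by (intro near) (simp add: dist_norm norm_minus_commute)
    then show "y \<in> unit_disc" using R by simp
  qed
  have zin: "z \<in> unit_disc" using z R by simp
  show "(f has_field_derivative deriv f z) (at z within cball 0 R)"
    by (rule holomorphic_derivI[OF f open_ball zin])
  have "norm ((deriv ^^ 1) f z) \<le> fact 1 * B / (S - R) ^ 1"
  proof (rule Cauchy_inequality)
    show "f holomorphic_on ball z (S - R)"
      using f sub ball_subset_cball by (blast intro: holomorphic_on_subset)
    show "continuous_on (cball z (S - R)) f"
      using f sub by (blast intro: holomorphic_on_imp_continuous_on holomorphic_on_subset)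
    show "norm (f y) \<le> B" if "norm (z - y) = S - R" for y
      using that by (intro bd near) (simp add: norm_minus_commute)
  qed (use R in simp)
  then show "norm (deriv f z) \<le> B / (S - R)" by simp
qed (use u v in auto)

section \<open>Compositions of self-maps that approach the identity\<close>

locale near_identity =
  fixes k :: "nat \<Rightarrow> complex \<Rightarrow> complex"
  assumes self: "\<And>n. n \<ge> 1 \<Longrightarrow> disc_self_map (k n)"
    and near: "\<And>r. r < 1 \<Longrightarrow>
      \<exists>e. summable e \<and> (\<forall>n w. norm w \<le> r \<longrightarrow> norm (k (Suc n) w - w) \<le> e n)"
begin

lemmas comp_self = disc_self_map_left_comp[of k, OF self]

text \<open>
  Iterating \<open>one_minus_norm_self_map_ge\<close> multiplies \<open>1 - \<bar>z\<bar>\<^sup>2\<close> by factors whose product converges to a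
  positive number, since \<open>\<Sum>\<^sub>n \<bar>k\<^sub>n(0)\<bar>\<close> is finite.
\<close>
lemma orbits_bounded:
  assumes r: "0 \<le> r" "r < 1"
  obtains R where "R < 1" "\<And>n z. norm z \<le> r \<Longrightarrow> norm (left_comp k n z) \<le> R"
proof -
  obtain e where e: "summable e" "\<And>n. norm (k (Suc n) 0) \<le> e n"
    using near[of 0] by auto
  define x where "x n = 2 * norm (k (Suc n) 0) / (1 + norm (k (Suc n) 0))" for n
  have x0: "0 \<le> x n" for n by (simp add: x_def)
  have x1: "x n < 1" for n
  proof -
    have "norm (k (Suc n) 0) < 1" using disc_self_map_norm[OF self[of "Suc n"], of 0] by simp
    moreover have "1 + norm (k (Suc n) 0) > 0" by (simp add: add_pos_nonneg)
    ultimately show ?thesis by (simp add: x_def)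
  qed
  have "x n \<le> 2 * e n" for n
  proof -
    have "x n \<le> 2 * norm (k (Suc n) 0) / 1"
      unfolding x_def by (intro divide_left_mono) (auto simp: add_pos_nonneg)
    then show ?thesis using e(2)[of n] by simp
  qed
  then have sx: "summable x"
    using x0 by (intro summable_comparison_test'[OF summable_mult[OF e(1), of 2], of 0]) auto
  obtain P where P: "P > 0" "\<And>n. P \<le> (\<Prod>i<n. 1 - x i)"
    using prod_one_minus_bounded_below[OF x0 x1 sx] by blast
  define R where "R = sqrt (1 - P * (1 - r\<^sup>2))"
  have r2: "1 - r\<^sup>2 > 0" using r by (simp add: abs_square_less_1)
  show thesis
  proof
    show "R < 1" using P(1) r2 by (simp add: R_def)
    fix n z assume z: "norm (z::complex) \<le> r"
    define u where "u m = 1 - (norm (left_comp k m z))\<^sup>2" for m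
    have u0: "1 - r\<^sup>2 \<le> u 0" using z by (simp add: u_def power_mono)
    have "P * (1 - r\<^sup>2) \<le> (\<Prod>i<n. 1 - x i) * u 0"
      using P(1) less_le_trans[OF P(1) P(2)[of n]] r2 u0 by (intro mult_mono P(2)) auto
    also have "\<dots> \<le> u n"
    proof (rule recursive_lower_bound[OF _ x1])
      fix m
      have "norm (left_comp k m z) < 1" using disc_self_map_norm[OF comp_self, of z m] z r by simp
      then show "(1 - x m) * u m \<le> u (Suc m)"
        using one_minus_norm_self_map_ge[OF self[of "Suc m"]] by (simp add: u_def x_def)
    qed
    finally have "(norm (left_comp k n z))\<^sup>2 \<le> 1 - P * (1 - r\<^sup>2)" by (simp add: u_def)
    then show "norm (left_comp k n z) \<le> R"
      unfolding R_def by (rule real_le_rsqrt)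
  qed
qed

text \<open>
  The orbits of \<open>cball 0 r\<close> stay in some \<open>cball 0 R\<close>, so the increments of \<open>left_comp k\<close> are bounded by the
  summable bounds for \<open>k\<^sub>n - id\<close> on that disc, and the M-test applies to the telescoping series.
\<close>
lemma converges:
  obtains g where "disc_self_map g"
    "\<And>r. r < 1 \<Longrightarrow> uniform_limit (cball 0 r) (left_comp k) g sequentially"
proof -
  define G where "G = left_comp k"
  define g where "g z = z + suminf (\<lambda>n. G (Suc n) z - G n z)" for z
  have lim: "uniform_limit (cball 0 r) G g sequentially" if r: "r < 1" for r
  proof (cases "r \<ge> 0")
    case False
    then show ?thesis by simp
  next
    case r0: True
    obtain R where R: "R < 1" "\<And>n z. norm z \<le> r \<Longrightarrow> norm (G n z) \<le> R"
      using orbits_bounded[OF r0 r] unfolding G_def by blast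
    obtain e where e: "summable e" "\<And>n w. norm w \<le> R \<Longrightarrow> norm (k (Suc n) w - w) \<le> e n"
      using near[OF R(1)] by blast
    have "uniform_limit (cball 0 r) (\<lambda>n z. \<Sum>i<n. G (Suc i) z - G i z)
        (\<lambda>z. suminf (\<lambda>n. G (Suc n) z - G n z)) sequentially"
      using e R by (intro Weierstrass_m_test[of _ _ e]) (auto simp: G_def)
    from uniform_limit_add[OF uniform_limit_const this]
    have "uniform_limit (cball 0 r) (\<lambda>n z. z + (\<Sum>i<n. G (Suc i) z - G i z)) g sequentially"
      unfolding g_def .
    moreover have "z + (\<Sum>i<n. G (Suc i) z - G i z) = G n z" for n z
      using sum_lessThan_telescope[of "\<lambda>i. G i z" n] by (simp add: G_def)
    ultimately show ?thesis by simp
  qed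
  have "g holomorphic_on unit_disc"
  proof (rule holomorphic_uniform_sequence[of _ G])
    show "G n holomorphic_on unit_disc" for n
      using comp_self unfolding G_def disc_self_map_def by blast
    fix z :: complex assume z: "z \<in> unit_disc"
    define d where "d = (1 - norm z) / 2"
    have sub: "cball z d \<subseteq> cball 0 (norm z + d)"
      by (simp add: cball_subset_cball_iff dist_norm)
    have "norm z + d < 1" using z by (simp add: d_def field_simps)
    with sub show "\<exists>d>0. cball z d \<subseteq> unit_disc \<and> uniform_limit (cball z d) G g sequentially"
      using z by (intro exI[of _ d] conjI uniform_limit_on_subset[OF lim sub])
        (auto simp: d_def)
  qed simp
  moreover have "g z \<in> unit_disc" if z: "z \<in> unit_disc" for z
  proof -
    obtain R where R: "R < 1" "\<And>n y. norm y \<le> norm z \<Longrightarrow> norm (G n y) \<le> R"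
      using orbits_bounded[of "norm z"] z unfolding G_def by auto
    have "(\<lambda>n. G n z) \<longlonglongrightarrow> g z"
      using z by (intro tendsto_uniform_limitI[OF lim[of "norm z"]]) auto
    then have "norm (g z) \<le> R"
      using R(2)[of z] by (intro Lim_norm_ubound[of sequentially "\<lambda>n. G n z"]) auto
    then show ?thesis using R(1) by simp
  qed
  ultimately have "disc_self_map g" by (auto simp: disc_self_map_def)
  then show thesis using lim that unfolding G_def by blast
qed

text \<open>
  If \<open>k\<^sub>n - id\<close> has Lipschitz constant \<open>y\<^sub>n\<close> on a disc that contains two orbits, the step \<open>k\<^sub>n\<close> multiplies
  their distance by at least \<open>1 - y\<^sub>n\<close>. Once all \<open>y\<^sub>n < 1\<close>, the product of these factors
  is bounded away from 0.
\<close>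
lemma limit_not_constant:
  assumes nc: "\<And>n. n \<ge> 1 \<Longrightarrow> \<not> k n constant_on unit_disc"
    and lim: "\<And>z. z \<in> unit_disc \<Longrightarrow> (\<lambda>n. left_comp k n z) \<longlonglongrightarrow> g z"
  shows "\<not> g constant_on unit_disc"
proof -
  define G where "G = left_comp k"
  \<comment> \<open>The starting disc is chosen before \<open>N\<close>: the radius \<open>R\<close>, and with it the Lipschitz constants and \<open>N\<close>,
    must not depend on the points \<open>z\<close> and \<open>z'\<close>, which can only be chosen once \<open>N\<close> is known.\<close>
  obtain R where R: "R < 1" "\<And>n z. norm z \<le> 1/2 \<Longrightarrow> norm (G n z) \<le> R"
    using orbits_bounded[of "1/2"] unfolding G_def by auto
  define S where "S = (1 + R) / 2"
  have S: "R < S" "S < 1" using R by (auto simp: S_def)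
  obtain e where e: "summable e" "\<And>n w. norm w \<le> S \<Longrightarrow> norm (k (Suc n) w - w) \<le> e n"
    using near[OF S(2)] by blast
  define y where "y n = e n / (S - R)" for n
  have S0: "0 \<le> S" using order.trans[OF norm_ge_zero R(2)[of 0 0]] S by simp
  have e0: "0 \<le> e n" for n using order.trans[OF norm_ge_zero e(2)[of 0 n]] S0 by simp
  have y: "summable y" "\<And>n. 0 \<le> y n"
    unfolding y_def using e e0 S by (auto intro: summable_divide)
  have "y \<longlonglongrightarrow> 0" by (rule summable_LIMSEQ_zero[OF y(1)])
  then have "eventually (\<lambda>n. y n < 1) sequentially" by (rule order_tendstoD) simp
  then obtain N where N: "\<And>n. n \<ge> N \<Longrightarrow> y n < 1"
    by (auto simp: eventually_sequentially)
  have "\<not> G N constant_on ball 0 (1/2)"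
    unfolding G_def by (rule left_comp_not_constant_on[OF self nc]) auto
  then obtain z z' where z: "norm z < 1/2" "norm z' < 1/2" "G N z \<noteq> G N z'"
    unfolding constant_on_def by (metis mem_ball_0 norm_zero zero_less_divide_1_iff zero_less_numeral)
  define u where "u n = norm (G (n + N) z - G (n + N) z')" for n
  obtain P where P: "P > 0" "\<And>n. P \<le> (\<Prod>i<n. 1 - y (i + N))"
    using prod_one_minus_bounded_below[of "\<lambda>n. y (n + N)"] y N by (auto simp: summable_iff_shift)
  have rec: "(1 - y (n + N)) * u n \<le> u (Suc n)" for n
  proof -
    let ?h = "\<lambda>w. k (Suc (n + N)) w - w"
    let ?a = "G (n + N) z" and ?b = "G (n + N) z'"
    have "norm (?h ?a - ?h ?b) \<le> y (n + N) * u n"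
      unfolding y_def u_def
    proof (rule Lipschitz_of_bounded_holomorphic[OF _ S e(2)])
      show "?h holomorphic_on unit_disc"
        using self[of "Suc (n + N)"] by (auto simp: disc_self_map_def intro!: holomorphic_intros)
    qed (use z in \<open>auto intro!: R(2)\<close>)
    moreover have "u n \<le> u (Suc n) + norm (?h ?a - ?h ?b)"
    proof -
      have "?a - ?b = (G (Suc n + N) z - G (Suc n + N) z') - (?h ?a - ?h ?b)"
        by (simp add: G_def)
      then show ?thesis unfolding u_def by (metis norm_triangle_ineq4)
    qed
    ultimately show ?thesis by (simp add: algebra_simps)
  qed
  have low: "P * u 0 \<le> u n" for n
  proof -
    have "P * u 0 \<le> (\<Prod>i<n. 1 - y (i + N)) * u 0"
      by (intro mult_right_mono P(2)) (simp add: u_def)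
    also have "\<dots> \<le> u n"
      by (rule recursive_lower_bound[of "\<lambda>n. y (n + N)"]) (use rec N in auto)
    finally show ?thesis .
  qed
  have "(\<lambda>n. G (n + N) z) \<longlonglongrightarrow> g z" "(\<lambda>n. G (n + N) z') \<longlonglongrightarrow> g z'"
    unfolding G_def using z by (intro LIMSEQ_ignore_initial_segment lim; simp)+
  then have "u \<longlonglongrightarrow> norm (g z - g z')"
    unfolding u_def by (intro tendsto_intros)
  then have "P * u 0 \<le> norm (g z - g z')"
    using low by (intro LIMSEQ_le_const) auto
  moreover have "P * u 0 > 0" using P z by (simp add: u_def)
  ultimately have "g z \<noteq> g z'" by auto
  then show ?thesis using z by (intro not_constant_onI[of g z z']) auto
qed

end

section \<open>Transfer to the elliptic map\<close>

text \<open>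
  A self-map does not increase the pseudo-hyperbolic distance \<open>\<bar>M u v\<bar>\<close>, which dominates half the
  Euclidean one and is at most the hyperbolic one. It is used for the automorphism that conjugates
  the elliptic map to a rotation, so that only Euclidean distances remain.
\<close>
lemma norm_diff_le_hyperbolic_dist:
  assumes h: "disc_self_map h" and u: "norm u < 1" and v: "norm v < 1"
  shows "norm (h u - h v) \<le> 2 * hyperbolic_dist u v"
proof -
  define x where "x = norm (M u v)"
  have x: "0 \<le> x" "x < 1" using Moebius_function_norm_lt_1[OF u v] by (auto simp: x_def)
  note lt = disc_self_map_norm[OF h u] disc_self_map_norm[OF h v]
  have "norm (h u - h v) = norm (M (h u) (h v)) * norm (1 - cnj (h u) * h v)"
    using disc_denom_nonzero[OF lt]
    by (simp add: Moebius_function_simple norm_divide norm_minus_commute)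
  also have "\<dots> \<le> x * 2"
    unfolding x_def
    by (intro mult_mono Schwarz_Pick[OF h u v] norm_Moebius_denom(2)[OF lt]) auto
  also have "x \<le> 2 * artanh x"
  proof -
    have "x \<le> - ln (1 - x)" using x ln_le_minus_one[of "1 - x"] by simp
    also have "\<dots> \<le> ln (1 + x) - ln (1 - x)" using x by simp
    also have "\<dots> = 2 * artanh x" using x by (simp add: artanh_def ln_div)
    finally show ?thesis .
  qed
  finally show ?thesis
    unfolding hyperbolic_dist_eq_artanh[OF u v] x_def[symmetric] by simp
qed

lemma disc_self_map_rotation: "norm c = 1 \<Longrightarrow> disc_self_map (\<lambda>w. c * w)"
  by (auto simp: disc_self_map_def norm_mult intro!: holomorphic_intros)

lemma disc_automorphism_inverse:
  assumes "disc_automorphism \<phi>"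
  obtains \<psi> where "disc_self_map \<phi>" "disc_self_map \<psi>"
    "\<And>z. z \<in> unit_disc \<Longrightarrow> \<psi> (\<phi> z) = z" "\<And>w. w \<in> unit_disc \<Longrightarrow> \<phi> (\<psi> w) = w"
proof -
  have hol: "\<phi> holomorphic_on unit_disc" and inj: "inj_on \<phi> unit_disc"
    and im: "\<phi> ` unit_disc = unit_disc"
    using assms by (auto simp: disc_automorphism_def bij_betw_def)
  obtain \<psi> where \<psi>: "\<psi> holomorphic_on \<phi> ` unit_disc" "\<And>z. z \<in> unit_disc \<Longrightarrow> \<psi> (\<phi> z) = z"
    using holomorphic_has_inverse[OF hol open_ball inj] by metis
  have in_disc: "\<psi> w \<in> unit_disc \<and> \<phi> (\<psi> w) = w" if "w \<in> unit_disc" for w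
  proof -
    have "w \<in> \<phi> ` unit_disc" using that im by simp
    then obtain z where "z \<in> unit_disc" "w = \<phi> z" by blast
    then show ?thesis using \<psi>(2)[of z] by simp
  qed
  show thesis
  proof
    show "disc_self_map \<phi>" "disc_self_map \<psi>"
      using hol im \<psi>(1) in_disc by (auto simp: disc_self_map_def)
  qed (use \<psi>(2) in_disc in auto)
qed

lemma identity_disc_elliptic:
  assumes "\<forall>z\<in>unit_disc. f z = z"
  shows "disc_elliptic f"
proof -
  have id: "disc_automorphism id" by (simp add: disc_automorphism_def)
  have "f holomorphic_on unit_disc"
    using assms by (intro holomorphic_transform[OF holomorphic_on_id]) auto
  moreover have "bij_betw f unit_disc unit_disc"
    using assms by (subst bij_betw_cong[of _ f id]) auto
  ultimately show ?thesis
    using id assms unfolding disc_elliptic_def disc_automorphism_def[of f]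
    by (intro conjI exI[of _ id] exI[of _ 1]) auto
qed

theorem theorem2p2:
  fixes f :: "complex \<Rightarrow> complex" and fs :: "nat \<Rightarrow> complex \<Rightarrow> complex" and a b :: complex
  assumes f: "(\<forall>z\<in>unit_disc. f z = z) \<or> disc_elliptic f"
    and self: "\<And>n. n \<ge> 1 \<Longrightarrow> disc_self_map (fs n)"
    and nonconst: "\<And>n. n \<ge> 1 \<Longrightarrow> \<not> fs n constant_on unit_disc"
    and ab: "a \<in> unit_disc" "b \<in> unit_disc" "a \<noteq> b"
    and sum_a: "summable (\<lambda>n. hyperbolic_dist (fs (Suc n) a) (f a))"
    and sum_b: "summable (\<lambda>n. hyperbolic_dist (fs (Suc n) b) (f b))"
  shows "\<exists>g. disc_self_map g \<and> \<not> g constant_on unit_disc \<and>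
           converges_locally_uniformly_on_disc (\<lambda>n. disc_inv_iter f n \<circ> left_comp fs n) g"
proof -
  have "disc_elliptic f" using f identity_disc_elliptic by blast
  then obtain \<phi> c where bij: "bij_betw f unit_disc unit_disc" and aut: "disc_automorphism \<phi>"
    and c: "norm c = 1" and conj: "\<And>z. z \<in> unit_disc \<Longrightarrow> \<phi> (f z) = c * \<phi> z"
    unfolding disc_elliptic_def disc_automorphism_def[of f] by blast
  obtain \<psi> where \<phi>: "disc_self_map \<phi>" and \<psi>: "disc_self_map \<psi>"
    and \<psi>\<phi>: "\<And>z. z \<in> unit_disc \<Longrightarrow> \<psi> (\<phi> z) = z"
    and \<phi>\<psi>: "\<And>w. w \<in> unit_disc \<Longrightarrow> \<phi> (\<psi> w) = w"
    by (rule disc_automorphism_inverse[OF aut]) blast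
  have c0: "c \<noteq> 0" using c by auto
  have \<phi>_in: "\<phi> z \<in> unit_disc" if "z \<in> unit_disc" for z
    using disc_self_map_norm[OF \<phi>] that by simp
  have \<psi>_in: "\<psi> z \<in> unit_disc" if "z \<in> unit_disc" for z
    using disc_self_map_norm[OF \<psi>] that by simp
  have rot_in: "w / c ^ n \<in> unit_disc" "c ^ n * w \<in> unit_disc" if "w \<in> unit_disc" for w n
    using that c by (simp_all add: norm_mult norm_divide norm_power)
  have F_in: "left_comp fs n z \<in> unit_disc" if "z \<in> unit_disc" for n z
  proof -
    have "disc_self_map (left_comp fs n)" by (rule disc_self_map_left_comp[OF self])
    from disc_self_map_norm[OF this] show ?thesis using that by simp
  qed
  define k where "k n w = \<phi> (fs n (\<psi> (c ^ (n - 1) * w))) / c ^ n" for n w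
  have k_comp: "left_comp k n (\<phi> z) = \<phi> (left_comp fs n z) / c ^ n" if z: "z \<in> unit_disc" for n z
  proof (induction n)
    case (Suc n)
    then show ?case using c0 F_in[OF z] by (simp add: k_def \<psi>\<phi>)
  qed simp
  have inv_iter: "disc_inv_iter f n u = \<psi> (\<phi> u / c ^ n)" if u: "u \<in> unit_disc" for n u
  proof -
    have bijn: "bij_betw (f ^^ n) unit_disc unit_disc" by (rule bij_betw_funpow[OF bij])
    have iter: "(f ^^ n) v \<in> unit_disc \<and> \<phi> ((f ^^ n) v) = c ^ n * \<phi> v" if v: "v \<in> unit_disc" for v
    proof (induction n)
      case (Suc n)
      then show ?case using bij_betwE[OF bij] conj by simp
    qed (use v in simp)
    define v where "v = \<psi> (\<phi> u / c ^ n)"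
    have w: "\<phi> u / c ^ n \<in> unit_disc" by (intro rot_in \<phi>_in u)
    then have v: "v \<in> unit_disc" unfolding v_def by (rule \<psi>_in)
    have "\<phi> ((f ^^ n) v) = \<phi> u" using iter[OF v] \<phi>\<psi>[OF w] c0 by (simp add: v_def)
    then have "(f ^^ n) v = u" using \<psi>\<phi>[OF u] \<psi>\<phi>[of "(f ^^ n) v"] iter[OF v] by metis
    then show ?thesis
      unfolding disc_inv_iter_def v_def[symmetric]
      using bijn v by (intro inv_into_f_eq) (auto simp: bij_betw_def)
  qed
  have k_self: "disc_self_map (k n)" if n: "n \<ge> 1" for n
  proof -
    have eq: "k n = (\<lambda>w. inverse (c ^ n) * w) \<circ> (\<phi> \<circ> (fs n \<circ> (\<psi> \<circ> (\<lambda>w. c ^ (n - 1) * w))))"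
      by (auto simp: k_def field_simps)
    show ?thesis
      unfolding eq using c by (intro disc_self_map_compose disc_self_map_rotation \<phi> \<psi> self n)
        (simp_all add: norm_inverse norm_power)
  qed
  have k_nonconst: "\<not> k n constant_on unit_disc" if n: "n \<ge> 1" for n
  proof
    assume "k n constant_on unit_disc"
    then obtain y where y: "\<And>w. w \<in> unit_disc \<Longrightarrow> k n w = y" by (auto simp: constant_on_def)
    have "fs n z = \<psi> (c ^ n * y)" if z: "z \<in> unit_disc" for z
    proof -
      have "k n (\<phi> z / c ^ (n - 1)) = y" by (intro y rot_in \<phi>_in z)
      then have "\<phi> (fs n z) = c ^ n * y" using c0 z by (simp add: k_def \<psi>\<phi> field_simps)
      moreover have "fs n z \<in> unit_disc" using disc_self_map_norm[OF self[OF n]] z by simp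
      ultimately show ?thesis using \<psi>\<phi> by metis
    qed
    then show False using nonconst[OF n] unfolding constant_on_def by blast
  qed
  interpret near_identity k
  proof
    fix r :: real assume r: "r < 1"
    have "\<phi> a \<noteq> \<phi> b" using ab \<psi>\<phi> by metis
    then obtain C where C: "\<And>h z. disc_self_map h \<Longrightarrow> norm z \<le> r \<Longrightarrow>
        norm (h z - z) \<le> C * (norm (h (\<phi> a) - \<phi> a) + norm (h (\<phi> b) - \<phi> b))"
      using two_point_stability[of "\<phi> a" "\<phi> b" r] \<phi>_in[OF ab(1)] \<phi>_in[OF ab(2)] r by auto
    define e where "e n = \<bar>C\<bar> * (2 * hyperbolic_dist (fs (Suc n) a) (f a)
        + 2 * hyperbolic_dist (fs (Suc n) b) (f b))" for n
    have "summable e"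
      unfolding e_def by (intro summable_mult summable_add sum_a sum_b)
    moreover have "norm (k (Suc n) w - w) \<le> e n" if w: "norm w \<le> r" for n w
    proof -
      define h where "h = (\<lambda>w. inverse c * w) \<circ> (\<phi> \<circ> (fs (Suc n) \<circ> \<psi>))"
      have h: "disc_self_map h"
        unfolding h_def using c
        by (intro disc_self_map_compose disc_self_map_rotation \<phi> \<psi> self) (simp_all add: norm_inverse)
      have move: "norm (h (\<phi> z) - \<phi> z) \<le> 2 * hyperbolic_dist (fs (Suc n) z) (f z)"
        if z: "z \<in> unit_disc" for z
      proof -
        have "h (\<phi> z) - \<phi> z = (\<phi> (fs (Suc n) z) - \<phi> (f z)) / c"
          using c0 by (simp add: h_def \<psi>\<phi>[OF z] conj[OF z] field_simps)
        then have "norm (h (\<phi> z) - \<phi> z) = norm (\<phi> (fs (Suc n) z) - \<phi> (f z))"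
          using c by (simp add: norm_divide)
        also have "\<dots> \<le> 2 * hyperbolic_dist (fs (Suc n) z) (f z)"
          using z disc_self_map_norm[OF self[of "Suc n"], of z] bij_betwE[OF bij]
          by (intro norm_diff_le_hyperbolic_dist[OF \<phi>]) auto
        finally show ?thesis .
      qed
      \<comment> \<open>Rotating by \<open>c\<^sup>n\<close> turns \<open>k (Suc n)\<close> into \<open>h\<close> and preserves \<open>\<bar>w\<bar> \<le> r\<close>.\<close>
      have "k (Suc n) w - w = (h (c ^ n * w) - c ^ n * w) / c ^ n"
        using c0 by (simp add: k_def h_def field_simps)
      then have "norm (k (Suc n) w - w) = norm (h (c ^ n * w) - c ^ n * w)"
        using c by (simp add: norm_divide norm_power)
      also have "\<dots> \<le> C * (norm (h (\<phi> a) - \<phi> a) + norm (h (\<phi> b) - \<phi> b))"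
        using w c by (intro C h) (simp add: norm_mult norm_power)
      also have "\<dots> \<le> \<bar>C\<bar> * (norm (h (\<phi> a) - \<phi> a) + norm (h (\<phi> b) - \<phi> b))"
        by (intro mult_right_mono) auto
      also have "\<dots> \<le> e n"
        unfolding e_def by (intro mult_left_mono add_mono move ab) auto
      finally show ?thesis .
    qed
    ultimately show "\<exists>e. summable e \<and> (\<forall>n w. norm w \<le> r \<longrightarrow> norm (k (Suc n) w - w) \<le> e n)"
      by blast
  qed (rule k_self)
  obtain G where G: "disc_self_map G"
    and lim: "\<And>r. r < 1 \<Longrightarrow> uniform_limit (cball 0 r) (left_comp k) G sequentially"
    using converges by blast
  have "(\<lambda>n. left_comp k n z) \<longlonglongrightarrow> G z" if "z \<in> unit_disc" for z
    using that by (intro tendsto_uniform_limitI[OF lim[of "norm z"]]) auto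
  then have G_nonconst: "\<not> G constant_on unit_disc"
    using limit_not_constant[OF k_nonconst] by blast
  define g where "g = \<psi> \<circ> (G \<circ> \<phi>)"
  have "disc_self_map g" unfolding g_def by (intro disc_self_map_compose \<phi> \<psi> G)
  moreover have "\<not> g constant_on unit_disc"
  proof
    assume "g constant_on unit_disc"
    then obtain y where y: "\<And>z. z \<in> unit_disc \<Longrightarrow> g z = y" by (auto simp: constant_on_def)
    have "G w = \<phi> y" if w: "w \<in> unit_disc" for w
    proof -
      have "\<psi> (G w) = y" using y[OF \<psi>_in[OF w]] \<phi>\<psi>[OF w] by (simp add: g_def)
      moreover have "G w \<in> unit_disc" using disc_self_map_norm[OF G] w by simp
      ultimately show ?thesis using \<phi>\<psi> by metis
    qed
    then show False using G_nonconst unfolding constant_on_def by blast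
  qed
  moreover have "converges_locally_uniformly_on_disc (\<lambda>n. disc_inv_iter f n \<circ> left_comp fs n) g"
    unfolding converges_locally_uniformly_on_disc_def
  proof (intro allI impI)
    fix K :: "complex set" assume K: "compact K \<and> K \<subseteq> unit_disc"
    have cont: "continuous_on unit_disc \<phi>" "continuous_on unit_disc \<psi>"
      using \<phi> \<psi> by (auto simp: disc_self_map_def holomorphic_on_imp_continuous_on)
    obtain r where r: "0 \<le> r" "r < 1" "\<And>z. z \<in> K \<Longrightarrow> norm (\<phi> z) \<le> r"
    proof (cases "K = {}")
      case True
      then show ?thesis using that[of 0] by simp
    next
      case False
      have "continuous_on K (\<lambda>z. norm (\<phi> z))"
        using K cont by (intro continuous_intros) (auto intro: continuous_on_subset)
      then obtain z where "z \<in> K" "\<forall>y\<in>K. norm (\<phi> y) \<le> norm (\<phi> z)"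
        using continuous_attains_sup[of K "\<lambda>z. norm (\<phi> z)"] K False by blast
      then show ?thesis using that[of "norm (\<phi> z)"] \<phi>_in[of z] K by auto
    qed
    \<comment> \<open>\<open>\<psi>\<close> is uniformly continuous on compact subsets of the disc, and this compact disc contains
      all values of \<open>left_comp k n\<close> on \<open>\<phi> ` K\<close>.\<close>
    obtain R where R: "R < 1" "\<And>n z. norm z \<le> r \<Longrightarrow> norm (left_comp k n z) \<le> R"
      using orbits_bounded[OF r(1,2)] by blast
    have "uniform_limit K (\<lambda>n z. left_comp k n (\<phi> z)) (\<lambda>z. G (\<phi> z)) sequentially"
      by (rule uniform_limit_compose'[OF lim[OF r(2)]]) (use r(3) in auto)
    then have "uniform_limit K (\<lambda>n z. \<psi> (left_comp k n (\<phi> z))) (\<lambda>z. \<psi> (G (\<phi> z))) sequentially"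
    proof (rule uniform_limit_compose_uniformly_continuous_on)
      have "continuous_on (cball 0 R) \<psi>"
        using R(1) by (intro continuous_on_subset[OF cont(2)]) auto
      then show "uniformly_continuous_on (cball 0 R) \<psi>"
        by (rule compact_uniformly_continuous) simp
    qed (use R(2) r(3) in auto)
    moreover have "(disc_inv_iter f n \<circ> left_comp fs n) z = \<psi> (left_comp k n (\<phi> z))"
      if "z \<in> K" for n z
    proof -
      have z: "z \<in> unit_disc" using that K by blast
      show ?thesis using F_in[OF z] by (simp add: inv_iter k_comp[OF z])
    qed
    ultimately show "uniform_limit K (\<lambda>n. disc_inv_iter f n \<circ> left_comp fs n) g sequentially"
      by (subst uniform_limit_cong'[of K _ "\<lambda>n z. \<psi> (left_comp k n (\<phi> z))" g "\<lambda>z. \<psi> (G (\<phi> z))"])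
        (simp_all add: g_def)
  qed
  ultimately show ?thesis by blast
qed

end
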